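(* The localization number of the incidence graph of any Steiner triple system $\mathrm{STS}(v)$ is at most $\frac{v+1}{2}$.
   Context: A Steiner triple system $\mathrm{STS}(v)$ ($v \ge 7$) is a set $X$ of $v$ points with a collection of $3$-element subsets (blocks) such that every pair of distinct points lies in exactly one block. Its incidence graph is the bipartite graph on points and blocks with $x \sim B$ iff $x \in B$. Localization game on a connected graph $G$ with $k$ cops: the robber chooses a starting vertex, invisible to the cops. Each round the cops choose any $k$ vertices (no adjacency restriction) and each learns its distance to the robber; the cops win if after finitely many rounds they determine the robber's vertex uniquely; otherwise the robber moves to a neighbour or stays. The robber knows the cops' strategy. The localization number $\zeta(G)$ is the least $k$ for which $k$ cops can guarantee capture. *)

theory Defs
  imports Complex_Main
begin

definition steiner_triple_system :: "nat \<Rightarrow> 'a set \<Rightarrow> 'a set set \<Rightarrow> bool" where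
  "steiner_triple_system v X \<B> \<longleftrightarrow>
     finite X \<and> card X = v \<and>
     (\<forall>B\<in>\<B>. B \<subseteq> X \<and> card B = 3) \<and>
     (\<forall>x\<in>X. \<forall>y\<in>X. x \<noteq> y \<longrightarrow> (\<exists>!B. B \<in> \<B> \<and> x \<in> B \<and> y \<in> B))"

text \<open>A graph is given by its vertex set and its symmetric adjacency relation.
  In the incidence graph, points are tagged \<open>Inl\<close> and blocks \<open>Inr\<close>.\<close>

definition incidence_verts :: "'a set \<Rightarrow> 'a set set \<Rightarrow> ('a + 'a set) set" where
  "incidence_verts X \<B> = Inl ` X \<union> Inr ` \<B>"

definition incidence_adj :: "'a set \<Rightarrow> 'a set set \<Rightarrow> (('a + 'a set) \<times> ('a + 'a set)) set" where
  "incidence_adj X \<B> =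
     {(Inl x, Inr B) | x B. x \<in> X \<and> B \<in> \<B> \<and> x \<in> B} \<union>
     {(Inr B, Inl x) | x B. x \<in> X \<and> B \<in> \<B> \<and> x \<in> B}"

text \<open>Meaningful only for connected graphs, where a walk from \<open>u\<close> to \<open>w\<close> exists.\<close>

definition graph_dist :: "('v \<times> 'v) set \<Rightarrow> 'v \<Rightarrow> 'v \<Rightarrow> nat" where
  "graph_dist E u w = (LEAST n. (u, w) \<in> E ^^ n)"

text \<open>The value \<open>r n\<close> is the robber's vertex when the cops probe in round \<open>n\<close>; rounds are
  counted from 0.\<close>

definition robber_walk :: "'v set \<Rightarrow> ('v \<times> 'v) set \<Rightarrow> (nat \<Rightarrow> 'v) \<Rightarrow> bool" where
  "robber_walk V E r \<longleftrightarrow> r 0 \<in> V \<and> (\<forall>n. r (Suc n) = r n \<or> (r n, r (Suc n)) \<in> E)"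

text \<open>A strategy maps the distance vectors learned in the previous rounds to the vertices
  probed next. Several cops may use the same vertex.\<close>

type_synonym 'v cop_strategy = "nat list list \<Rightarrow> 'v list"

definition cop_strategy :: "'v set \<Rightarrow> nat \<Rightarrow> 'v cop_strategy \<Rightarrow> bool" where
  "cop_strategy V k \<sigma> \<longleftrightarrow> (\<forall>h. length (\<sigma> h) = k \<and> set (\<sigma> h) \<subseteq> V)"

text \<open>The distance vectors learned in rounds \<open>0, \<dots>, n - 1\<close>.\<close>

primrec learned :: "('v \<times> 'v) set \<Rightarrow> 'v cop_strategy \<Rightarrow> (nat \<Rightarrow> 'v) \<Rightarrow> nat \<Rightarrow> nat list list" where
  "learned E \<sigma> r 0 = []"
| "learned E \<sigma> r (Suc n) =
     learned E \<sigma> r n @ [map (\<lambda>c. graph_dist E c (r n)) (\<sigma> (learned E \<sigma> r n))]"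

text \<open>After the probe of round \<open>n\<close>, every robber walk compatible with all the distances learned
  so far is at the same vertex.\<close>

definition located :: "'v set \<Rightarrow> ('v \<times> 'v) set \<Rightarrow> 'v cop_strategy \<Rightarrow> (nat \<Rightarrow> 'v) \<Rightarrow> nat \<Rightarrow> bool" where
  "located V E \<sigma> r n \<longleftrightarrow>
     (\<forall>r'. robber_walk V E r' \<and> learned E \<sigma> r' (Suc n) = learned E \<sigma> r (Suc n) \<longrightarrow> r' n = r n)"

text \<open>Since \<open>\<sigma>\<close> is deterministic, a robber who knows the cops' strategy is modelled by
  quantifying over all robber walks after \<open>\<sigma>\<close> has been fixed.\<close>

definition cops_win :: "'v set \<Rightarrow> ('v \<times> 'v) set \<Rightarrow> nat \<Rightarrow> bool" where
  "cops_win V E k \<longleftrightarrow>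
     (\<exists>\<sigma>. cop_strategy V k \<sigma> \<and> (\<forall>r. robber_walk V E r \<longrightarrow> (\<exists>n. located V E \<sigma> r n)))"

definition localization_number :: "'v set \<Rightarrow> ('v \<times> 'v) set \<Rightarrow> nat" where
  "localization_number V E = (LEAST k. cops_win V E k)"

text \<open>The minimum above is attained on finite connected graphs, as one cop on every vertex wins.\<close>

lemma graph_dist_eq_0:
  assumes "(u, w) \<in> E\<^sup>*"
  shows "graph_dist E u w = 0 \<longleftrightarrow> u = w"
proof
  assume "graph_dist E u w = 0"
  moreover have "(u, w) \<in> E ^^ graph_dist E u w"
    unfolding graph_dist_def using assms by (metis LeastI rtrancl_power)
  ultimately show "u = w" by simp
next
  assume "u = w"
  then show "graph_dist E u w = 0"
    unfolding graph_dist_def by (intro Least_eq_0) simp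
qed

lemma cops_win_card_verts:
  assumes "finite V" and conn: "\<And>u w. u \<in> V \<Longrightarrow> w \<in> V \<Longrightarrow> (u, w) \<in> E\<^sup>*"
  shows "cops_win V E (card V)"
proof -
  obtain cs where cs: "set cs = V" "length cs = card V"
    using finite_distinct_list[OF \<open>finite V\<close>] distinct_card by metis
  have "located V E (\<lambda>_. cs) r 0" if r: "robber_walk V E r" for r
    unfolding located_def
  proof (intro allI impI)
    fix r' assume A: "robber_walk V E r' \<and> learned E (\<lambda>_. cs) r' (Suc 0) = learned E (\<lambda>_. cs) r (Suc 0)"
    have V: "r 0 \<in> V" "r' 0 \<in> V" using r A by (auto simp: robber_walk_def)
    have "\<forall>c\<in>V. graph_dist E c (r' 0) = graph_dist E c (r 0)" using A cs by auto
    then have "graph_dist E (r 0) (r' 0) = 0"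
      using V graph_dist_eq_0[OF conn, of "r 0" "r 0"] by simp
    then show "r' 0 = r 0" using graph_dist_eq_0[OF conn] V by metis
  qed
  then show ?thesis
    unfolding cops_win_def cop_strategy_def using cs by (intro exI[of _ "\<lambda>_. cs"]) auto
qed

lemma cops_win_localization_number:
  assumes "finite V" and "\<And>u w. u \<in> V \<Longrightarrow> w \<in> V \<Longrightarrow> (u, w) \<in> E\<^sup>*"
  shows "cops_win V E (localization_number V E)"
  unfolding localization_number_def using cops_win_card_verts[OF assms] by (rule LeastI)

end

theory Submission
  imports Defs
begin

text \<open>Once the robber is known to have been at one of two points \<open>y\<close>, \<open>z\<close>, the cops win in a
  single probe: let \<open>w\<close> be the third point of the block on \<open>y\<close> and \<open>z\<close>. The blocks on \<open>y\<close>
  and the blocks on \<open>z\<close> induce two perfect matchings on the other \<open>v - 3\<close> points, whose union is a disjoint union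
  of even cycles. Probing \<open>y\<close> and one colour class \<open>A\<close> of a proper 2-colouring identifies every
  block on \<open>y\<close> or \<open>z\<close>, since each such block other than \<open>{y, z, w}\<close> meets \<open>A\<close>.

  To reach this situation, the cops first probe a point \<open>x\<close> and all blocks on \<open>x\<close>. A robber at a
  point is then confined to the two other points of one block on \<open>x\<close>. A robber at a block
  \<open>{a, b, c}\<close> not on \<open>x\<close> is confined to the transversals of three pairs \<open>{a, a'}\<close>, \<open>{b, b'}\<close>,
  \<open>{c, c'}\<close>; probing \<open>a, a', b, b'\<close> next locates him or confines him to \<open>{c, c'}\<close>.\<close>

section \<open>Games with a restricted set of starting vertices\<close>

text \<open>\<open>S\<close> holds the vertices where the robber may be at the start. The cops may
  probe all of \<open>V\<close> and the robber may leave \<open>S\<close> later, so the remainder of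
  a game is again a game of this kind.\<close>

definition cops_win_from :: "'v set \<Rightarrow> ('v \<times> 'v) set \<Rightarrow> nat \<Rightarrow> 'v set \<Rightarrow> bool" where
  "cops_win_from V E k S \<longleftrightarrow>
     (\<exists>\<sigma>. cop_strategy V k \<sigma> \<and> (\<forall>r. robber_walk S E r \<longrightarrow> (\<exists>n. located S E \<sigma> r n)))"

lemma cops_win_from_verts: "cops_win_from V E k V \<longleftrightarrow> cops_win V E k"
  by (simp add: cops_win_from_def cops_win_def)

text \<open>The same strategy works, as there are fewer walks to tell apart.\<close>

lemma cops_win_from_mono:
  assumes "cops_win_from V E k T" "S \<subseteq> T"
  shows "cops_win_from V E k S"
proof -
  have walk: "robber_walk T E r" if "robber_walk S E r" for r
    using that assms(2) by (auto simp: robber_walk_def)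
  obtain \<sigma> where "cop_strategy V k \<sigma>"
    and "\<And>r. robber_walk T E r \<Longrightarrow> \<exists>n. located T E \<sigma> r n"
    using assms(1) by (auto simp: cops_win_from_def)
  moreover have "located S E \<sigma> r n" if "located T E \<sigma> r n" for r n
    using that walk unfolding located_def by blast
  ultimately show ?thesis unfolding cops_win_from_def using walk by blast
qed

text \<open>One round of play: the answer leaves the class \<open>C\<close> of candidates that would
  give it, and the robber's move enlarges \<open>C\<close> to its closed neighbourhood. Winning
  strategies for these neighbourhoods, one per answer, are glued behind the probe
  \<open>cs\<close>.\<close>

lemma cops_win_from_probe_list:
  assumes cs: "set cs \<subseteq> V" "length cs = k"
    and step: "\<And>u C. u \<in> S \<Longrightarrow> C = {w \<in> S. \<forall>c\<in>set cs. graph_dist E c w = graph_dist E c u} \<Longrightarrow>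
      C \<subseteq> {u} \<or> cops_win_from V E k (C \<union> E `` C)"
  shows "cops_win_from V E k S"
proof -
  define obs where "obs u = map (\<lambda>c. graph_dist E c u) cs" for u
  define cl where "cl d = {w \<in> S. obs w = d}" for d
  define nb where "nb d = cl d \<union> E `` cl d" for d
  \<comment> \<open>The implication yields a legal strategy for every \<open>d\<close>, even where
    no win is known; the constant probe \<open>cs\<close> is the default there.\<close>
  have "\<exists>\<tau>. cop_strategy V k \<tau> \<and> (cops_win_from V E k (nb d) \<longrightarrow>
      (\<forall>r. robber_walk (nb d) E r \<longrightarrow> (\<exists>n. located (nb d) E \<tau> r n)))" for d
  proof (cases "cops_win_from V E k (nb d)")
    case True
    then show ?thesis by (auto simp: cops_win_from_def)
  next
    case False
    then show ?thesis using cs by (intro exI[of _ "\<lambda>_. cs"]) (auto simp: cop_strategy_def)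
  qed
  then obtain \<tau> where \<tau>: "\<And>d. cop_strategy V k (\<tau> d)"
    and win: "\<And>d r. cops_win_from V E k (nb d) \<Longrightarrow> robber_walk (nb d) E r \<Longrightarrow>
      \<exists>n. located (nb d) E (\<tau> d) r n"
    by metis
  define \<sigma> where "\<sigma> h = (case h of [] \<Rightarrow> cs | d # h' \<Rightarrow> \<tau> d h')" for h
  have strat: "cop_strategy V k \<sigma>"
    using \<tau> cs by (auto simp: cop_strategy_def \<sigma>_def split: list.split)
  \<comment> \<open>From the second round on, \<open>\<sigma>\<close> plays the strategy chosen by
    the first answer against the walk shifted by one.\<close>
  have learned: "learned E \<sigma> r (Suc n) =
      obs (r 0) # learned E (\<tau> (obs (r 0))) (\<lambda>i. r (Suc i)) n" for r n
    by (induction n) (simp_all add: \<sigma>_def obs_def)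
  have tail: "robber_walk (nb (obs (r 0))) E (\<lambda>i. r (Suc i))" if "robber_walk S E r" for r
  proof -
    have "r 0 \<in> cl (obs (r 0))" using that by (simp add: robber_walk_def cl_def)
    moreover have "r (Suc 0) = r 0 \<or> (r 0, r (Suc 0)) \<in> E" using that by (simp add: robber_walk_def)
    ultimately have "r (Suc 0) \<in> nb (obs (r 0))" unfolding nb_def by auto
    then show ?thesis using that by (simp add: robber_walk_def)
  qed
  have "\<exists>n. located S E \<sigma> r n" if r: "robber_walk S E r" for r
  proof -
    have r0: "r 0 \<in> S" using r by (simp add: robber_walk_def)
    have "cl (obs (r 0)) = {w \<in> S. \<forall>c\<in>set cs. graph_dist E c w = graph_dist E c (r 0)}"
      by (auto simp: cl_def obs_def)
    from step[OF r0 this] consider "cl (obs (r 0)) \<subseteq> {r 0}" | "cops_win_from V E k (nb (obs (r 0)))"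
      by (auto simp: nb_def)
    then show ?thesis
    proof cases
      case 1
      have "located S E \<sigma> r 0"
        unfolding located_def learned using 1 by (auto simp: robber_walk_def cl_def)
      then show ?thesis ..
    next
      case 2
      from win[OF 2 tail[OF r]] obtain n
        where n: "located (nb (obs (r 0))) E (\<tau> (obs (r 0))) (\<lambda>i. r (Suc i)) n" ..
      have "located S E \<sigma> r (Suc n)"
        unfolding located_def
      proof (intro allI impI)
        fix r' assume r': "robber_walk S E r' \<and>
          learned E \<sigma> r' (Suc (Suc n)) = learned E \<sigma> r (Suc (Suc n))"
        \<comment> \<open>Equal histories start with equal answers, so both tails are walks in the
          same subgame, where \<open>n\<close> applies.\<close>
        then have "obs (r' 0) = obs (r 0)" unfolding learned by simp
        then show "r' (Suc n) = r (Suc n)"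
          using n r' tail[of r'] unfolding located_def learned[of _ "Suc n"] list.inject by metis
      qed
      then show ?thesis ..
    qed
  qed
  then show ?thesis using strat by (auto simp: cops_win_from_def)
qed

text \<open>Surplus cops repeat a vertex of \<open>P\<close>, so only an upper bound on the number
  of probed vertices matters.\<close>

lemma cops_win_from_probe:
  assumes P: "finite P" "P \<noteq> {}" "P \<subseteq> V" "card P \<le> k"
    and step: "\<And>u C. u \<in> S \<Longrightarrow> C = {w \<in> S. \<forall>c\<in>P. graph_dist E c w = graph_dist E c u} \<Longrightarrow>
      C \<subseteq> {u} \<or> cops_win_from V E k (C \<union> E `` C)"
  shows "cops_win_from V E k S"
proof -
  obtain cs where cs: "set cs = P" "length cs = card P"
    using finite_distinct_list[OF P(1)] distinct_card by metis
  obtain p where p: "p \<in> P" using P(2) by auto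
  have "set (cs @ replicate (k - card P) p) = P" using cs p by auto
  then show ?thesis
    using cs P step by (intro cops_win_from_probe_list[of "cs @ replicate (k - card P) p"]) auto
qed

section \<open>Two-colouring a union of two perfect matchings\<close>

text \<open>Fixed-point-free involutions are perfect matchings. The induction removes one pair
  matched by \<open>f\<close>; the rest stays matched by \<open>f\<close>, so only \<open>U\<close>
  and \<open>g\<close> vary.\<close>

lemma two_colouring_of_involutions:
  assumes "finite U"
    and "\<And>u. u \<in> U \<Longrightarrow> f u \<in> U \<and> f u \<noteq> u \<and> f (f u) = u"
    and "\<And>u. u \<in> U \<Longrightarrow> g u \<in> U \<and> g u \<noteq> u \<and> g (g u) = u"
  obtains A where "A \<subseteq> U"
    and "\<And>u. u \<in> U \<Longrightarrow> f u \<in> A \<longleftrightarrow> u \<notin> A"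
    and "\<And>u. u \<in> U \<Longrightarrow> g u \<in> A \<longleftrightarrow> u \<notin> A"
proof -
  have "\<exists>A\<subseteq>U. \<forall>u\<in>U. (f u \<in> A \<longleftrightarrow> u \<notin> A) \<and> (g u \<in> A \<longleftrightarrow> u \<notin> A)"
    using assms
  proof (induction "card U" arbitrary: U g rule: less_induct)
    case less
    note f = less.prems(2) and g = less.prems(3)
    show ?case
    proof (cases "U = {}")
      case False
      then obtain p where p: "p \<in> U" by auto
      define q where "q = f p"
      have q: "q \<in> U" "q \<noteq> p" "f q = p" "f p = q" using f[OF p] by (auto simp: q_def)
      define U' where "U' = U - {p, q}"
      have U': "finite U'" "card U' < card U"
        using less.prems(1) p by (auto simp: U'_def intro!: psubset_card_mono)
      have f': "f u \<in> U' \<and> f u \<noteq> u \<and> f (f u) = u" if "u \<in> U'" for u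
        using that f[of u] q by (auto simp: U'_def)
      show ?thesis
      proof (cases "g p = q")
        \<comment> \<open>Both matchings join \<open>p\<close> and \<open>q\<close>, which therefore
          form a component of their own and can be coloured independently of the rest.\<close>
        case True
        then have gq: "g q = p" using g[OF p] by auto
        have g': "g u \<in> U' \<and> g u \<noteq> u \<and> g (g u) = u" if "u \<in> U'" for u
          using that g[of u] True gq by (auto simp: U'_def)
        obtain A where A: "A \<subseteq> U'"
          "\<And>u. u \<in> U' \<Longrightarrow> (f u \<in> A \<longleftrightarrow> u \<notin> A) \<and> (g u \<in> A \<longleftrightarrow> u \<notin> A)"
          using less.hyps[OF U'(2) U'(1) f' g'] by blast
        have "(f u \<in> insert p A \<longleftrightarrow> u \<notin> insert p A) \<and> (g u \<in> insert p A \<longleftrightarrow> u \<notin> insert p A)"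
          if "u \<in> U" for u
        proof (cases "u \<in> U'")
          case u: True
          then show ?thesis using A(2)[OF u] f'[OF u] g'[OF u] by (auto simp: U'_def)
        next
          case u: False
          then have "u = p \<or> u = q" using that by (auto simp: U'_def)
          then show ?thesis using A(1) q True gq by (auto simp: U'_def)
        qed
        moreover have "insert p A \<subseteq> U" using A(1) p by (auto simp: U'_def)
        ultimately show ?thesis by blast
      next
        case False
        \<comment> \<open>Contract the path \<open>g p, p, q, g q\<close> to a single edge of the second matching.\<close>
        define a where "a = g p"
        define b where "b = g q"
        have a: "a \<in> U" "a \<noteq> p" "a \<noteq> q" "g a = p" "g p = a"
          using g[OF p] False by (auto simp: a_def)
        have b: "b \<in> U" "b \<noteq> q" "b \<noteq> p" "g b = q" "g q = b"
          using g[OF q(1)] False by (auto simp: b_def)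
        have ab: "a \<noteq> b" using a b q by auto
        define g' where "g' u = (if u = a then b else if u = b then a else g u)" for u
        have g': "g' u \<in> U' \<and> g' u \<noteq> u \<and> g' (g' u) = u" if "u \<in> U'" for u
        proof (cases "u = a \<or> u = b")
          case True
          then show ?thesis using a b ab by (auto simp: g'_def U'_def)
        next
          case False
          then have "g u \<noteq> a" "g u \<noteq> b" "g u \<noteq> p" "g u \<noteq> q"
            using that g[of u] a b by (auto simp: U'_def)
          then show ?thesis using False that g[of u] by (auto simp: g'_def U'_def)
        qed
        obtain A where A: "A \<subseteq> U'"
          "\<And>u. u \<in> U' \<Longrightarrow> (f u \<in> A \<longleftrightarrow> u \<notin> A) \<and> (g' u \<in> A \<longleftrightarrow> u \<notin> A)"
          using less.hyps[OF U'(2) U'(1) f' g'] by blast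
        have "a \<in> U'" using a by (auto simp: U'_def)
        from A(2)[OF this] have abA: "b \<in> A \<longleftrightarrow> a \<notin> A" by (simp add: g'_def)
        \<comment> \<open>\<open>p\<close> gets the colour opposite to \<open>a\<close>, and
          \<open>q\<close> the colour opposite to \<open>b\<close>. As \<open>g'\<close> matches
          \<open>a\<close> with \<open>b\<close>, these differ, so \<open>p\<close> and
          \<open>q\<close> differ as \<open>f\<close> demands.\<close>
        define A' where "A' = insert (if a \<in> A then q else p) A"
        have old: "u \<in> A' \<longleftrightarrow> u \<in> A" if "u \<in> U'" for u
          using that by (auto simp: A'_def U'_def)
        have new: "p \<in> A' \<longleftrightarrow> a \<notin> A" "q \<in> A' \<longleftrightarrow> a \<in> A"
          using A(1) q(2) by (auto simp: A'_def U'_def)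
        have a': "a \<in> A' \<longleftrightarrow> a \<in> A" and b': "b \<in> A' \<longleftrightarrow> a \<notin> A"
          using old abA a b by (auto simp: U'_def)
        have "(f u \<in> A' \<longleftrightarrow> u \<notin> A') \<and> (g u \<in> A' \<longleftrightarrow> u \<notin> A')" if u: "u \<in> U" for u
        proof -
          consider "u = p" | "u = q" | "u = a" | "u = b" | "u \<in> U'" "u \<noteq> a" "u \<noteq> b"
            using u by (auto simp: U'_def)
          then show ?thesis
          proof cases
            case 3
            then have "u \<in> U'" using a by (auto simp: U'_def)
            then show ?thesis using 3 A(2) old f' a new by metis
          next
            case 4
            then have "u \<in> U'" using b by (auto simp: U'_def)
            then show ?thesis using 4 A(2) old f' b abA new by metis
          next
            case 5
            then have "g' u = g u" by (simp add: g'_def)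
            then show ?thesis using A(2) old f' g' 5(1) by metis
          qed (use new a' b' q a b in auto)
        qed
        moreover have "A' \<subseteq> U" using A(1) p q by (auto simp: A'_def U'_def)
        ultimately show ?thesis by blast
      qed
    qed simp
  qed
  then show thesis using that by blast
qed

section \<open>Steiner triple systems and distances in their incidence graphs\<close>

locale steiner_system =
  fixes X :: "'a set" and \<B> :: "'a set set"
  assumes sts: "steiner_triple_system (card X) X \<B>"
begin

abbreviation "V \<equiv> incidence_verts X \<B>"
abbreviation "E \<equiv> incidence_adj X \<B>"

lemma finite_points: "finite X"
  and block_subset: "B \<in> \<B> \<Longrightarrow> B \<subseteq> X"
  and card_block: "B \<in> \<B> \<Longrightarrow> card B = 3"
  and ex1_block: "x \<in> X \<Longrightarrow> y \<in> X \<Longrightarrow> x \<noteq> y \<Longrightarrow> \<exists>!B. B \<in> \<B> \<and> x \<in> B \<and> y \<in> B"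
  using sts unfolding steiner_triple_system_def by blast+

lemma block_eqI:
  assumes "B \<in> \<B>" "D \<in> \<B>" "x \<in> B" "y \<in> B" "x \<in> D" "y \<in> D" "x \<noteq> y"
  shows "B = D"
  using assms ex1_block[of x y] block_subset by blast

section \<open>Third points of blocks and the number of blocks on a point\<close>

definition third :: "'a \<Rightarrow> 'a \<Rightarrow> 'a" where
  "third x y = (SOME z. z \<noteq> x \<and> z \<noteq> y \<and> {x, y, z} \<in> \<B>)"

lemma third:
  assumes "x \<in> X" "y \<in> X" "x \<noteq> y"
  shows "third x y \<noteq> x" "third x y \<noteq> y" "{x, y, third x y} \<in> \<B>" "third x y \<in> X"
proof -
  obtain B where B: "B \<in> \<B>" "x \<in> B" "y \<in> B" using ex1_block[OF assms] by blast
  obtain a b c where abc: "B = {a, b, c}" "a \<noteq> b" "b \<noteq> c" "a \<noteq> c"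
    using card_block[OF B(1)] by (auto simp: card_3_iff)
  have "\<exists>z. z \<noteq> x \<and> z \<noteq> y \<and> B = {x, y, z}"
    using abc B(2,3) assms(3) by auto
  then have "\<exists>z. z \<noteq> x \<and> z \<noteq> y \<and> {x, y, z} \<in> \<B>" using B(1) by auto
  from someI_ex[OF this]
  show *: "third x y \<noteq> x" "third x y \<noteq> y" "{x, y, third x y} \<in> \<B>" by (auto simp: third_def)
  then show "third x y \<in> X" using block_subset by blast
qed

lemma block_eq:
  assumes "B \<in> \<B>" "x \<in> B" "y \<in> B" "x \<noteq> y"
  shows "B = {x, y, third x y}"
proof (rule block_eqI[of _ _ x y])
  show "{x, y, third x y} \<in> \<B>" using third(3)[of x y] block_subset[OF assms(1)] assms by blast
qed (use assms in auto)

lemma third_eqI: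
  assumes "{x, y, z} \<in> \<B>" "x \<noteq> y" "z \<noteq> x" "z \<noteq> y"
  shows "third x y = z"
proof -
  have "z \<in> {x, y, third x y}" using block_eq[OF assms(1), of x y] assms(2) by blast
  then show ?thesis using assms by blast
qed

text \<open>So \<open>third x\<close> is the matching that the blocks on \<open>x\<close> induce on
  the other points.\<close>

lemma third_third:
  assumes "x \<in> X" "y \<in> X" "x \<noteq> y"
  shows "third x (third x y) = y"
  using third[OF assms] assms by (intro third_eqI) (auto simp: insert_commute)

lemma third_commute:
  assumes "x \<in> X" "y \<in> X" "x \<noteq> y"
  shows "third y x = third x y"
  using third[OF assms] assms by (intro third_eqI) (auto simp: insert_commute)

lemma finite_blocks: "finite \<B>"
  using finite_points block_subset by (intro finite_subset[of \<B> "Pow X"]) auto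

text \<open>With \<open>x\<close> removed, the blocks on \<open>x\<close> partition the remaining
  points into pairs. In particular \<open>card X\<close> is odd.\<close>

lemma card_blocks_on_point:
  assumes "x \<in> X"
  shows "2 * card {B \<in> \<B>. x \<in> B} = card X - 1"
proof -
  let ?P = "{B \<in> \<B>. x \<in> B}"
  have fin: "finite ?P" using finite_blocks by auto
  have "X - {x} = (\<Union>B\<in>?P. B - {x})"
  proof
    show "X - {x} \<subseteq> (\<Union>B\<in>?P. B - {x})"
    proof
      fix y assume "y \<in> X - {x}"
      then show "y \<in> (\<Union>B\<in>?P. B - {x})"
        using third(3)[OF assms, of y] by (intro UN_I[of "{x, y, third x y}"]) auto
    qed
  qed (use block_subset in auto)
  then have "card (X - {x}) = card (\<Union>B\<in>?P. B - {x})" by simp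
  also have "\<dots> = (\<Sum>B\<in>?P. card (B - {x}))"
    using fin block_eqI finite_subset[OF block_subset finite_points]
    by (intro card_UN_disjoint) auto
  also have "\<dots> = (\<Sum>B\<in>?P. 2)"
    using card_block by (intro sum.cong) auto
  finally show ?thesis using assms finite_points by simp
qed

section \<open>Adjacency, connectedness and distances in the incidence graph\<close>

lemma adj_iff [simp]:
  "(Inl x, Inr B) \<in> E \<longleftrightarrow> x \<in> B \<and> B \<in> \<B>"
  "(Inr B, Inl x) \<in> E \<longleftrightarrow> x \<in> B \<and> B \<in> \<B>"
  "(Inl x, Inl y) \<notin> E"
  "(Inr B, Inr D) \<notin> E"
  using block_subset by (auto simp: incidence_adj_def)

lemma vert_iff [simp]: "Inl x \<in> V \<longleftrightarrow> x \<in> X" "Inr B \<in> V \<longleftrightarrow> B \<in> \<B>"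
  by (auto simp: incidence_verts_def)

lemma connected:
  assumes "u \<in> V" "w \<in> V"
  shows "(u, w) \<in> E\<^sup>*"
proof -
  have pp: "(Inl x, Inl y) \<in> E\<^sup>*" if "x \<in> X" "y \<in> X" for x y
  proof (cases "x = y")
    case False
    then have "(Inl x, Inr {x, y, third x y}) \<in> E" "(Inr {x, y, third x y}, Inl y) \<in> E"
      using third(3)[of x y] that by auto
    then show ?thesis by (meson r_into_rtrancl rtrancl_trans)
  qed simp
  have nb: "\<exists>x\<in>X. (u, Inl x) \<in> E\<^sup>* \<and> (Inl x, u) \<in> E\<^sup>*" if "u \<in> V" for u
  proof (cases u)
    case (Inl x)
    then show ?thesis using that by auto
  next
    case (Inr B)
    then have "B \<in> \<B>" using that by auto
    moreover obtain x where "x \<in> B" using card_block[OF \<open>B \<in> \<B>\<close>] by fastforce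
    ultimately have "(Inr B, Inl x) \<in> E" "(Inl x, Inr B) \<in> E" "x \<in> X" using block_subset by auto
    then show ?thesis using Inr by blast
  qed
  obtain x y where "x \<in> X" "y \<in> X" "(u, Inl x) \<in> E\<^sup>*" "(Inl y, w) \<in> E\<^sup>*"
    using nb assms by meson
  then show ?thesis using pp by (meson rtrancl_trans)
qed

lemma dist_walk:
  assumes "u \<in> V" "w \<in> V"
  shows "(u, w) \<in> E ^^ graph_dist E u w"
  unfolding graph_dist_def using connected[OF assms] by (metis LeastI rtrancl_power)

lemma dist_eq_0:
  assumes "u \<in> V" "w \<in> V"
  shows "graph_dist E u w = 0 \<longleftrightarrow> u = w"
  using graph_dist_eq_0[OF connected[OF assms]] .

lemma dist_eq_1:
  assumes "u \<in> V" "w \<in> V" "isl u \<noteq> isl w"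
  shows "graph_dist E u w = 1 \<longleftrightarrow> (u, w) \<in> E"
proof
  assume "graph_dist E u w = 1"
  then show "(u, w) \<in> E" using dist_walk[OF assms(1,2)] by simp
next
  assume "(u, w) \<in> E"
  then have "(u, w) \<in> E ^^ 1" by simp
  then have "graph_dist E u w \<le> 1" unfolding graph_dist_def by (rule Least_le)
  moreover have "graph_dist E u w \<noteq> 0" using dist_eq_0 assms by auto
  ultimately show "graph_dist E u w = 1" by simp
qed

text \<open>Every edge switches between points and blocks. Hence a single probe already reveals on
  which side the robber is.\<close>

lemma even_walk: "(u, w) \<in> E ^^ n \<Longrightarrow> even n \<longleftrightarrow> isl u = isl w"
proof (induction n arbitrary: w)
  case (Suc n)
  then obtain t where t: "(u, t) \<in> E ^^ n" "(t, w) \<in> E" by auto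
  then have "isl t \<noteq> isl w" by (cases t; cases w) auto
  then show ?case using Suc.IH[OF t(1)] by auto
qed simp

lemma even_dist:
  assumes "u \<in> V" "w \<in> V"
  shows "even (graph_dist E u w) \<longleftrightarrow> isl u = isl w"
  using even_walk[OF dist_walk[OF assms]] .

text \<open>By parity the distance is 0 or 2 in this range, and 2 means passing through a common
  point. A probed block thus tells whether the robber's block meets it.\<close>

lemma dist_blocks_le_2:
  assumes "B \<in> \<B>" "D \<in> \<B>"
  shows "graph_dist E (Inr B) (Inr D) \<le> 2 \<longleftrightarrow> B \<inter> D \<noteq> {}"
proof
  let ?n = "graph_dist E (Inr B) (Inr D)"
  assume "?n \<le> 2"
  moreover have "even ?n" using even_dist assms by simp
  ultimately have "?n = 0 \<or> ?n = 2" by presburger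
  then show "B \<inter> D \<noteq> {}"
  proof
    assume "?n = 0"
    then show ?thesis using dist_eq_0 assms card_block by fastforce
  next
    assume "?n = 2"
    then have "(Inr B, Inr D) \<in> E ^^ 2" using dist_walk[of "Inr B" "Inr D"] assms by simp
    then obtain t where "(Inr B, t) \<in> E" "(t, Inr D) \<in> E" by (auto simp: numeral_2_eq_2)
    then show ?thesis by (cases t) auto
  qed
next
  assume "B \<inter> D \<noteq> {}"
  then obtain x where "(Inr B, Inl x) \<in> E" "(Inl x, Inr D) \<in> E" using assms by auto
  then have "(Inr B, Inr D) \<in> E O E" by (rule relcompI)
  then have "(Inr B, Inr D) \<in> E ^^ 2" by (simp add: numeral_2_eq_2)
  then show "graph_dist E (Inr B) (Inr D) \<le> 2" unfolding graph_dist_def by (rule Least_le)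
qed

section \<open>What equal answers to a probe reveal\<close>

lemma isl_eq_if_dist_eq:
  assumes "graph_dist E (Inl p) u = graph_dist E (Inl p) w" "p \<in> X" "u \<in> V" "w \<in> V"
  shows "isl u = isl w"
  using even_dist[of "Inl p" u] even_dist[of "Inl p" w] assms by auto

lemma eq_if_dist_eq_self:
  assumes "graph_dist E u w = graph_dist E u u" "u \<in> V" "w \<in> V"
  shows "w = u"
  using assms dist_eq_0 by metis

lemma mem_block_iff_if_dist_eq:
  assumes "graph_dist E (Inl p) (Inr B) = graph_dist E (Inl p) (Inr D)" "p \<in> X" "B \<in> \<B>" "D \<in> \<B>"
  shows "p \<in> B \<longleftrightarrow> p \<in> D"
  using dist_eq_1[of "Inl p" "Inr B"] dist_eq_1[of "Inl p" "Inr D"] assms by auto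

section \<open>The cops' strategy\<close>

text \<open>The starting set is where a robber at \<open>y\<close> or \<open>z\<close> can be one
  move later. The probe has at most 1 + (v - 3)/2 vertices, and each of its answers leaves a single
  candidate.\<close>

lemma cops_win_from_two_points:
  assumes yz: "y \<in> X" "z \<in> X" "y \<noteq> z" and k: "card X \<le> 2 * k"
  shows "cops_win_from V E k ({Inl y, Inl z} \<union> E `` {Inl y, Inl z})"
proof -
  define w where "w = third y z"
  note w = third[OF yz, folded w_def]
  have zy: "third z y = w" using third_commute[OF yz] by (simp add: w_def)
  define U where "U = X - {y, z, w}"
  have closed: "third p u \<in> U \<and> third p u \<noteq> u \<and> third p (third p u) = u"
    if "u \<in> U" "p = y \<or> p = z" for p u
  proof -
    have u: "u \<in> X" "p \<in> X" "p \<noteq> u" using that yz by (auto simp: U_def)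
    \<comment> \<open>\<open>third y\<close> exchanges \<open>z\<close> and \<open>w\<close>, and
      \<open>third z\<close> exchanges \<open>y\<close> and \<open>w\<close>; being involutions,
      both preserve \<open>U\<close>.\<close>
    have "third y w = z" "third z w = y"
      using third_third[OF yz] third_third[OF yz(2,1)] yz zy by (auto simp: w_def)
    then have "third p u \<notin> {y, z, w}"
      using third_third[OF u(2,1,3)] third(1)[OF u(2,1,3)] that zy by (auto simp: U_def w_def)
    then show ?thesis using third[OF u(2,1,3)] third_third[OF u(2,1,3)] by (auto simp: U_def)
  qed
  have finU: "finite U" using finite_points by (simp add: U_def)
  obtain A where A: "A \<subseteq> U" "\<And>u. u \<in> U \<Longrightarrow> third y u \<in> A \<longleftrightarrow> u \<notin> A"
    "\<And>u. u \<in> U \<Longrightarrow> third z u \<in> A \<longleftrightarrow> u \<notin> A"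
    using two_colouring_of_involutions[OF finU, of "third y" "third z"] closed by blast
  have AX: "A \<subseteq> X" and yA: "y \<notin> A" using A(1) by (auto simp: U_def)
  have finA: "finite A" using A(1) finU finite_subset by blast
  \<comment> \<open>\<open>third y\<close> maps \<open>A\<close> injectively into its complement, so
    \<open>A\<close> is at most half of \<open>U\<close>.\<close>
  have "inj_on (third y) A"
    using closed A(1) by (intro inj_on_inverseI[of _ "third y"]) auto
  moreover have "third y ` A \<subseteq> U - A" using closed[of _ y] A(1,2) by auto
  ultimately have "card A \<le> card (U - A)" using finU by (metis card_inj_on_le finite_Diff)
  also have "\<dots> = card U - card A" using finA A(1) by (simp add: card_Diff_subset)
  also have "card U = card X - 3"
    using yz w finite_points by (simp add: U_def card_Diff_subset)
  finally have cardA: "2 * card A \<le> card X - 3" by simp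
  \<comment> \<open>This keeps the subtraction in \<open>card X - 3\<close> from being
    truncated.\<close>
  have "card {y, z, w} \<le> card X" using yz w finite_points by (intro card_mono) auto
  then have "card X \<ge> 3" using yz w by simp
  then have card_probe: "card (insert y A) \<le> k" using cardA k finA yA by simp

  \<comment> \<open>The two points of \<open>B\<close> other than \<open>p\<close> lie in
    \<open>U\<close>, since \<open>B\<close> shares only one point with \<open>{y, z, w}\<close>.
    They are matched by \<open>third p\<close>, so one of them is in \<open>A\<close>.\<close>
  have meets: "B \<inter> A \<noteq> {}" if "B \<in> \<B>" "p \<in> B" "p = y \<or> p = z" "B \<noteq> {y, z, w}" for B p
  proof -
    have B3: "card (B - {p}) = 2" using card_block[OF that(1)] that(2) by simp
    then obtain u where u: "u \<in> B" "u \<noteq> p"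
      by (metis Diff_iff card.empty ex_in_conv singletonI zero_neq_numeral)
    have "u \<in> U"
      using block_eqI[of B "{y, z, w}" p u] that u w(1,2,3) block_subset[OF that(1)]
      by (auto simp: U_def)
    moreover have "third p u \<in> B" using block_eq[OF that(1,2) u(1)] u by auto
    ultimately show ?thesis using A(2,3) that(3) u(1) by blast
  qed
  have block_unique: "B = D"
    if B: "B \<in> \<B>" "y \<in> B \<or> z \<in> B" and D: "D \<in> \<B>" "y \<in> D \<or> z \<in> D"
      and same: "\<And>p. p \<in> insert y A \<Longrightarrow> p \<in> B \<longleftrightarrow> p \<in> D" for B D
  proof (cases "B \<inter> A = {}")
    case True
    \<comment> \<open>Only \<open>{y, z, w}\<close> misses \<open>A\<close>, so both blocks equal
      it.\<close>
    then have "D \<inter> A = {}" using same by blast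
    then show ?thesis using True meets B D by metis
  next
    case False
    then obtain a where a: "a \<in> A" "a \<in> B" "a \<in> D" using same by blast
    \<comment> \<open>As \<open>y\<close> is probed, either both blocks contain \<open>y\<close> or
      neither does, and then both contain \<open>z\<close>. With \<open>a\<close> this makes two
      common points.\<close>
    obtain p where "p = y \<or> p = z" "p \<in> B" "p \<in> D" using B(2) D(2) same by blast
    then show ?thesis using a A(1) B(1) D(1) block_eqI[of B D p a] by (auto simp: U_def)
  qed

  show ?thesis
  proof (rule cops_win_from_probe[of "Inl ` insert y A"])
    show "card (Inl ` insert y A :: ('a + 'a set) set) \<le> k"
      using card_probe finA card_image_le[of "insert y A" Inl] by (meson finite_insert le_trans)
    fix u C
    let ?S = "{Inl y, Inl z} \<union> E `` {Inl y, Inl z}"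
    assume u: "u \<in> ?S" and C: "C = {t \<in> ?S. \<forall>c\<in>Inl ` insert y A. graph_dist E c t = graph_dist E c u}"
    have SV: "t \<in> V" if "t \<in> ?S" for t using that yz by (cases t) auto
    have "t = u" if "t \<in> C" for t
    proof -
      have t: "t \<in> ?S" "\<And>p. p \<in> insert y A \<Longrightarrow> graph_dist E (Inl p) t = graph_dist E (Inl p) u"
        using that C by auto
      have isl: "isl t = isl u" using isl_eq_if_dist_eq[of y t u] t SV u yz by blast
      show ?thesis
      proof (cases u)
        case (Inl p)
        then obtain q where q: "t = Inl q" using isl by (cases t) auto
        have "p = y \<or> p = z" "q = y \<or> q = z" using u t(1) Inl q by auto
        moreover have "q = y \<longleftrightarrow> p = y"
          using t(2)[of y] dist_eq_0[of "Inl y" t] dist_eq_0[of "Inl y" u] SV[OF u] SV[OF t(1)] q Inl yz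
          by auto
        ultimately show ?thesis using q Inl by auto
      next
        case (Inr B)
        then obtain D where D: "t = Inr D" using isl by (cases t) auto
        have *: "B \<in> \<B>" "y \<in> B \<or> z \<in> B" "D \<in> \<B>" "y \<in> D \<or> z \<in> D"
          using u t(1) Inr D by auto
        have "p \<in> B \<longleftrightarrow> p \<in> D" if "p \<in> insert y A" for p
          using mem_block_iff_if_dist_eq[of p B D] t(2)[OF that] D Inr * AX yz that by auto
        then show ?thesis using block_unique[OF *] D Inr by simp
      qed
    qed
    then show "C \<subseteq> {u} \<or> cops_win_from V E k (C \<union> E `` C)" by blast
  qed (use finA AX yz in auto)
qed

text \<open>\<open>F\<close> stands for the blocks that the first probe cannot tell from
  \<open>B\<close>: they meet the same blocks on \<open>x\<close>, hence exactly those through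
  \<open>a\<close>, \<open>b\<close> and \<open>c\<close>.\<close>

lemma cops_win_from_transversals:
  assumes x: "x \<in> X" and B: "B \<in> \<B>" "x \<notin> B" and k: "card X \<le> 2 * k" "4 \<le> k"
    and F: "\<And>D. D \<in> F \<Longrightarrow> D \<in> \<B> \<and> x \<notin> D"
      "\<And>D L. D \<in> F \<Longrightarrow> L \<in> \<B> \<Longrightarrow> x \<in> L \<Longrightarrow> L \<inter> D = {} \<longleftrightarrow> L \<inter> B = {}"
  shows "cops_win_from V E k (Inr ` F \<union> E `` (Inr ` F))"
proof -
  obtain a b c where abc: "B = {a, b, c}" "a \<noteq> b" "b \<noteq> c" "a \<noteq> c"
    using card_block[OF B(1)] by (auto simp: card_3_iff)
  have pts: "a \<in> X" "b \<in> X" "c \<in> X" "x \<noteq> a" "x \<noteq> b" "x \<noteq> c"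
    using abc B block_subset[OF B(1)] by auto
  let ?a = "third x a" and ?b = "third x b" and ?c = "third x c"
  have sub: "D \<subseteq> {a, ?a, b, ?b, c, ?c}" if "D \<in> F" for D
  proof
    fix p assume p: "p \<in> D"
    have px: "p \<in> X" "x \<noteq> p" using F(1)[OF that] p block_subset by auto
    let ?L = "{x, p, third x p}"
    have L: "?L \<in> \<B>" using third(3)[OF x px] .
    then have "?L \<inter> B \<noteq> {}" using F(2)[OF that L] p by auto
    then obtain q where "q \<in> B" "q = p \<or> q = third x p" using B(2) by auto
    then have "p = q \<or> p = third x q" "q \<in> B" using third_third[OF x px] by auto
    then show "p \<in> {a, ?a, b, ?b, c, ?c}" using abc by auto
  qed
  have hits: "q \<in> D \<or> third x q \<in> D" if D: "D \<in> F" and q: "q \<in> B" for D q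
  proof -
    have qx: "q \<in> X" "x \<noteq> q" using q B block_subset by auto
    have "{x, q, third x q} \<inter> D \<noteq> {}" using F(2)[OF D third(3)[OF x qx]] q by auto
    then show ?thesis using F(1)[OF D] by auto
  qed
  \<comment> \<open>If \<open>third x a\<close> were \<open>b\<close>, then \<open>B\<close> would
    be the block on \<open>x\<close> and \<open>a\<close>, but it avoids \<open>x\<close>; equal
    third points would force \<open>a = b\<close>.\<close>
  have disj: "{a, ?a} \<inter> {b, ?b} = {}"
  proof -
    have "third x a \<noteq> b"
      using block_eqI[OF third(3)[OF x pts(1,4)] B(1), of a b] abc B by auto
    moreover have "third x b \<noteq> a"
      using block_eqI[OF third(3)[OF x pts(2,5)] B(1), of a b] abc B by auto
    moreover have "third x a \<noteq> third x b"
      using third_third x pts abc by metis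
    ultimately show ?thesis using abc by auto
  qed
  have ths: "?a \<in> X" "?b \<in> X" "?c \<in> X" "c \<noteq> ?c" using third[OF x] pts by (auto dest: sym)
  let ?Q = "{a, ?a, b, ?b}"
  have QX: "?Q \<subseteq> X" using pts ths by auto
  have unique: "D = D'" if D: "D \<in> F" "D' \<in> F" and same: "\<And>p. p \<in> ?Q \<Longrightarrow> p \<in> D \<longleftrightarrow> p \<in> D'" for D D'
  proof -
    \<comment> \<open>\<open>D\<close> has a point in each of the two disjoint probed pairs, and
      these two points determine it.\<close>
    obtain p where p: "p \<in> {a, ?a}" "p \<in> D" using hits[OF D(1), of a] abc by auto
    obtain q where q: "q \<in> {b, ?b}" "q \<in> D" using hits[OF D(1), of b] abc by auto
    have "p \<noteq> q" using p q disj by auto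
    moreover have "p \<in> D'" "q \<in> D'" using same[of p] same[of q] p q by blast+
    ultimately show ?thesis using block_eqI[of D D' p q] F(1) D p q by auto
  qed
  show ?thesis
  proof (rule cops_win_from_probe[of "Inl ` ?Q"])
    have "card (Inl ` ?Q :: ('a + 'a set) set) \<le> card ?Q" by (rule card_image_le) simp
    also have "\<dots> \<le> 4" by (simp add: card_insert_if)
    finally show "card (Inl ` ?Q :: ('a + 'a set) set) \<le> k" using k by simp
    fix u C
    let ?S = "Inr ` F \<union> E `` (Inr ` F)"
    assume u: "u \<in> ?S" and C: "C = {t \<in> ?S. \<forall>p\<in>Inl ` ?Q. graph_dist E p t = graph_dist E p u}"
    have "p \<in> X" if "D \<in> F" "p \<in> D" for D p using that F(1) block_subset by blast
    then have SV: "t \<in> V" if "t \<in> ?S" for t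
      using that F(1) by (cases t) auto
    have CD: "t \<in> ?S" "\<And>p. p \<in> ?Q \<Longrightarrow> graph_dist E (Inl p) t = graph_dist E (Inl p) u" "isl t = isl u"
      if "t \<in> C" for t
      using that isl_eq_if_dist_eq[of a t u] SV[of t] SV[OF u] pts unfolding C by blast+
    consider D where "u = Inr D" | p where "u = Inl p" "p \<in> ?Q" | p where "u = Inl p" "p \<notin> ?Q"
      by (cases u) auto
    then show "C \<subseteq> {u} \<or> cops_win_from V E k (C \<union> E `` C)"
    proof cases
      case 1
      have "t = u" if t: "t \<in> C" for t
      proof -
        obtain D' where D': "t = Inr D'" using CD(3)[OF t] 1 by (cases t) auto
        have FF: "D \<in> F" "D' \<in> F" using u CD(1)[OF t] 1 D' by auto
        have "p \<in> D \<longleftrightarrow> p \<in> D'" if "p \<in> ?Q" for p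
          using mem_block_iff_if_dist_eq[of p D D'] CD(2)[OF t that] QX that F(1) FF 1 D' by auto
        then show ?thesis using unique[OF FF] 1 D' by blast
      qed
      then show ?thesis by blast
    next
      case 2
      have "t = u" if "t \<in> C" for t
        using eq_if_dist_eq_self[of u t] CD(1,2)[OF that] SV u 2 by blast
      then show ?thesis by blast
    next
      case 3
      \<comment> \<open>All points on blocks of \<open>F\<close> lie in the three pairs, and a
        candidate in \<open>?Q\<close> would have been found at distance 0.\<close>
      have "C \<subseteq> {Inl c, Inl ?c}"
      proof
        fix t assume t: "t \<in> C"
        obtain q where q: "t = Inl q" using CD(3)[OF t] 3 by (cases t) auto
        have "q \<notin> ?Q"
        proof
          assume "q \<in> ?Q"
          then have "u = t"
            using eq_if_dist_eq_self[of t u] CD(2)[OF t, of q] SV[OF u] SV[OF CD(1)[OF t]] q by simp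
          then show False using 3 q \<open>q \<in> ?Q\<close> by simp
        qed
        moreover obtain D where "D \<in> F" "q \<in> D" using CD(1)[OF t] q by auto
        ultimately show "t \<in> {Inl c, Inl ?c}" using sub[of D] q by auto
      qed
      then show ?thesis
        using cops_win_from_mono[OF cops_win_from_two_points[OF pts(3) ths(3,4) k(1)], of "C \<union> E `` C"]
        by blast
    qed
  qed (use QX in auto)
qed

lemma cops_win_incidence_graph:
  assumes "card X \<ge> 7"
  shows "cops_win V E ((card X + 1) div 2)"
proof -
  let ?k = "(card X + 1) div 2"
  obtain x where x: "x \<in> X" using assms by fastforce
  \<comment> \<open>The bound 4 pays for the probe of two pairs in the second round; this is where
    \<open>card X \<ge> 7\<close> enters.\<close>
  have k: "card X \<le> 2 * ?k" "4 \<le> ?k" using assms by linarith+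
  let ?L = "{L \<in> \<B>. x \<in> L}"
  let ?P = "insert (Inl x) (Inr ` ?L)"
  have fin: "finite ?L" using finite_blocks by simp
  have "cops_win_from V E ?k V"
  proof (rule cops_win_from_probe[of ?P])
    \<comment> \<open>The point \<open>x\<close> and the (v - 1)/2 blocks on it make exactly (v +
      1)/2 vertices.\<close>
    have "card ?P = card ?L + 1" using fin by (subst card_insert_disjoint) (auto simp: card_image)
    then show "card ?P \<le> ?k" using card_blocks_on_point[OF x] assms by linarith
    fix u C
    assume u: "u \<in> V" and C: "C = {t \<in> V. \<forall>p\<in>?P. graph_dist E p t = graph_dist E p u}"
    have CD: "t \<in> V" "\<And>p. p \<in> ?P \<Longrightarrow> graph_dist E p t = graph_dist E p u" "isl t = isl u"
      if "t \<in> C" for t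
      using that isl_eq_if_dist_eq[of x t u] u x unfolding C by blast+
    consider "u \<in> ?P" | p where "u = Inl p" "u \<notin> ?P" | B where "u = Inr B" "u \<notin> ?P"
      by (cases u) auto
    then show "C \<subseteq> {u} \<or> cops_win_from V E ?k (C \<union> E `` C)"
    proof cases
      case 1
      have "t = u" if "t \<in> C" for t
        using eq_if_dist_eq_self[of u t] CD(1,2)[OF that] u 1 by blast
      then show ?thesis by blast
    next
      case 2
      have p: "p \<in> X" "x \<noteq> p" using u 2 by auto
      note th = third[OF x p]
      have "C \<subseteq> {Inl p, Inl (third x p)}"
      proof
        fix t assume t: "t \<in> C"
        obtain q where q: "t = Inl q" using CD(3)[OF t] 2 by (cases t) auto
        let ?D = "{x, p, third x p}"
        \<comment> \<open>Distance 1 singles out the probed block through the robber's point, and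
          the probe of \<open>x\<close> excludes \<open>x\<close> itself.\<close>
        have "graph_dist E (Inr ?D) (Inl p) = 1"
          using dist_eq_1[of "Inr ?D" "Inl p"] th p by simp
        then have "graph_dist E (Inr ?D) (Inl q) = 1"
          using CD(2)[OF t, of "Inr ?D"] th(3) 2 q by simp
        then have "q \<in> ?D"
          using dist_eq_1[of "Inr ?D" "Inl q"] th CD(1)[OF t] q by simp
        moreover have "q \<noteq> x"
          using eq_if_dist_eq_self[of "Inl x" u] CD(2)[OF t, of "Inl x"] u x q 2 by auto
        ultimately show "t \<in> {Inl p, Inl (third x p)}" using q by auto
      qed
      then show ?thesis
        using cops_win_from_mono[OF cops_win_from_two_points[OF p(1) th(4) th(2)[symmetric] k(1)],
            of "C \<union> E `` C"]
        by blast
    next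
      case 3
      have B: "B \<in> \<B>" "x \<notin> B" using u 3 by auto
      define F where "F = {D. Inr D \<in> C}"
      have CF: "C = Inr ` F"
      proof
        show "C \<subseteq> Inr ` F"
        proof
          fix t assume t: "t \<in> C"
          then show "t \<in> Inr ` F" using CD(3)[OF t] 3 by (cases t) (auto simp: F_def)
        qed
      qed (auto simp: F_def)
      have F1: "D \<in> \<B> \<and> x \<notin> D" if "D \<in> F" for D
      proof -
        have D: "Inr D \<in> C" using that by (simp add: F_def)
        then show ?thesis
          using mem_block_iff_if_dist_eq[of x D B] CD(1)[OF D] CD(2)[OF D, of "Inl x"] B 3 x by simp
      qed
      have F2: "L \<inter> D = {} \<longleftrightarrow> L \<inter> B = {}" if "D \<in> F" "L \<in> \<B>" "x \<in> L" for D L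
      proof -
        have D: "Inr D \<in> C" using that by (simp add: F_def)
        \<comment> \<open>All blocks on \<open>x\<close> are probed, so \<open>D\<close> and
          \<open>B\<close> agree on which of them are within distance 2, that is, which of them they
          meet.\<close>
        have "graph_dist E (Inr L) (Inr D) = graph_dist E (Inr L) (Inr B)"
          using CD(2)[OF D, of "Inr L"] 3 that by simp
        then show ?thesis
          using dist_blocks_le_2[of L D] dist_blocks_le_2[of L B] F1[OF that(1)] B that by simp
      qed
      show ?thesis
        using cops_win_from_transversals[OF x B k F1 F2] CF by simp
    qed
  qed (use fin x in auto)
  then show ?thesis by (simp add: cops_win_from_verts)
qed

end

theorem theorem4p2:
  fixes X :: "'a set" and \<B> :: "'a set set" and v :: nat
  assumes "v \<ge> 7"
    and "steiner_triple_system v X \<B>"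
  shows "real (localization_number (incidence_verts X \<B>) (incidence_adj X \<B>)) \<le> (real v + 1) / 2"
proof -
  have v: "v = card X" using assms(2) by (simp add: steiner_triple_system_def)
  interpret steiner_system X \<B> using assms(2) v by unfold_locales simp
  have "localization_number V E \<le> (v + 1) div 2"
    unfolding localization_number_def using cops_win_incidence_graph assms(1) v by (intro Least_le) simp
  then have "2 * localization_number V E \<le> v + 1" by linarith
  then have "real (2 * localization_number V E) \<le> real (v + 1)" by (simp only: of_nat_le_iff)
  then show ?thesis by simp
qed

end
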